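(* Let $\gamma>1$ and let $A\in C(\mathbb{R},\mathrm{GL}^+(3,\mathbb{R}))\cap C^2(\mathbb{R},\mathbb{M}^3)$ be a solution of $$A''(t)=(\det A(t))^{1-\gamma}A(t)^{-\top}.$$ Let $\Omega_t=A(t)B$ with $B=\{y\in\mathbb{R}^3:|y|<1\}$. Then $$\operatorname{diam}\Omega_t\sim(\operatorname{tr}A(t)A(t)^\top)^{1/2}\sim1+|t|,\quad t\in\mathbb{R},$$ and $$1+|t|^p\lesssim\operatorname{vol}\Omega_t\sim\det A(t)\lesssim1+|t|^3,\quad t\in\mathbb{R},$$ with $$p=\begin{cases}3,&\text{if }1<\gamma\le5/3,\\ 2/(\gamma-1),&\text{if }\gamma>5/3.\end{cases}$$
   Context: $\mathbb{M}^3$ is the space of real $3\times3$ matrices, $\mathrm{GL}^+(3,\mathbb{R})=\{A\in\mathbb{M}^3:\det A>0\}$, $A^{-\top}=(A^{-1})^\top$. For nonnegative functions, $x\lesssim y$ means $x\le c\,y$ on the indicated range of $t$ for some constant $c>0$ (which may depend on $\gamma$ and on the solution $A$, but not on $t$); $x\sim y$ means $x\lesssim y$ and $y\lesssim x$. *)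

theory Defs
  imports "HOL-Analysis.Analysis"
begin

definition GL_plus :: "(real^3^3) set" where
  "GL_plus = {M. det M > 0}"

text \<open>
  The relations \<open>x \<lesssim> y\<close> and \<open>x \<sim> y\<close> between nonnegative functions of
  \<open>t\<close>, with one constant for all real \<open>t\<close> (not only for large \<open>t\<close>).
\<close>

definition dominated :: "(real \<Rightarrow> real) \<Rightarrow> (real \<Rightarrow> real) \<Rightarrow> bool" where
  "dominated x y \<longleftrightarrow> (\<exists>c>0. \<forall>t. x t \<le> c * y t)"

definition comparable :: "(real \<Rightarrow> real) \<Rightarrow> (real \<Rightarrow> real) \<Rightarrow> bool" where
  "comparable x y \<longleftrightarrow> dominated x y \<and> dominated y x"

definition moving_domain :: "(real \<Rightarrow> real^3^3) \<Rightarrow> real \<Rightarrow> (real^3) set" where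
  "moving_domain A t = (\<lambda>y. A t *v y) ` ball 0 1"

definition growth_exponent :: "real \<Rightarrow> real" where
  "growth_exponent \<gamma> = (if \<gamma> \<le> 5/3 then 3 else 2 / (\<gamma> - 1))"

end

theory Submission
  imports Defs
begin

text \<open>
  Everything rests on two quantities attached to the motion. With the internal energy
  \<open>U = (det A) powr (1 - \<gamma>) / (\<gamma> - 1)\<close>, Jacobi's formula for the derivative of the determinant
  gives \<open>U' = - A'' \<bullet> A'\<close> in the Frobenius inner product, so the total energy
  \<open>E = \<bar>A'\<bar>\<^sup>2 / 2 + U\<close> is conserved. The other identity is \<open>A \<bullet> A'' = 3 (\<gamma> - 1) U\<close>, because the inner
  product of \<open>A\<close> with its inverse transpose is the dimension.

  Size. Conservation of energy bounds the speed \<open>\<bar>A'\<bar>\<close>, so \<open>\<bar>A\<bar>\<close> grows at most linearly. In the other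
  direction \<open>(\<bar>A\<bar>\<^sup>2)'' = 2 \<bar>A'\<bar>\<^sup>2 + 6 (\<gamma> - 1) U\<close> is at least a positive multiple of \<open>E\<close>: the two terms
  are positive multiples of the two parts of the energy. Hence \<open>\<bar>A\<bar>\<^sup>2\<close> lies above a parabola and
  \<open>\<bar>A\<bar>\<close> grows at least linearly
  (\<open>norm_A_dominated\<close>, \<open>one_plus_abs_dominated\<close>). The Frobenius norm is the square root of the
  trace of \<open>A A\<^sup>T\<close> and is comparable with the diameter of the ellipsoid, and Hadamard's inequality
  turns the upper bound on \<open>\<bar>A\<bar>\<close> into the cubic upper bound on the determinant.

  Volume. The conformal energy \<open>H = \<bar>A - t A'\<bar>\<^sup>2 / 2 + t\<^sup>2 U\<close> measures the deviation from free
  expansion, and its derivative collapses to \<open>(5 - 3 \<gamma>) t U\<close>. Since \<open>t\<^sup>2 U \<le> H\<close>, this yields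
  \<open>t H' \<le> \<kappa> H\<close> for \<open>t > 0\<close> with \<open>\<kappa> = max 0 (5 - 3 \<gamma>)\<close>, so \<open>H\<close> grows at most like \<open>t powr \<kappa>\<close> and
  \<open>U\<close> decays at least like \<open>t powr (\<kappa> - 2)\<close> (\<open>internal_energy_decay\<close>). Solving for the determinant
  gives the exponent \<open>(2 - \<kappa>) / (\<gamma> - 1)\<close>, which is the growth exponent in both ranges of \<open>\<gamma>\<close>; the
  threshold \<open>5/3\<close> is where \<open>\<kappa>\<close> becomes zero. Negative times are covered by time reversal, and
  bounded times by compactness.
\<close>

section \<open>Matrices and the Frobenius inner product\<close>

lemma trace_matrix_mult_transpose:
  fixes A B :: "real^'n^'m"
  shows "trace (A ** transpose B) = A \<bullet> B"
  by (simp add: trace_def matrix_matrix_mult_def transpose_def inner_vec_def)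

lemma matrix_inv_inverse:
  fixes A :: "real^'n^'n"
  assumes "det A \<noteq> 0"
  shows "A ** matrix_inv A = mat 1" and "matrix_inv A ** A = mat 1"
  using someI_ex[OF assms[folded invertible_det_nz, unfolded invertible_def]]
  by (simp_all add: matrix_inv_def)

lemma inner_transpose_matrix_inv:
  fixes A :: "real^'n^'n"
  assumes "det A \<noteq> 0"
  shows "A \<bullet> transpose (matrix_inv A) = real CARD('n)"
proof -
  have "A \<bullet> transpose (matrix_inv A) = trace (A ** matrix_inv A)"
    by (metis trace_matrix_mult_transpose transpose_transpose)
  also have "\<dots> = trace (mat 1 :: real^'n^'n)"
    using assms by (simp add: matrix_inv_inverse)
  finally show ?thesis by (simp add: trace_I)
qed

lemma norm_matrix_vector_mult_le:
  fixes A :: "real^'n^'m"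
  shows "norm (A *v x) \<le> norm A * norm x"
proof -
  have "norm (A *v x) \<le> L2_set (\<lambda>i. norm (A $ i) * norm x) UNIV"
    unfolding norm_vec_def[of "A *v x"]
    by (rule L2_set_mono) (simp_all add: matrix_vector_mul_component Cauchy_Schwarz_ineq2)
  also have "\<dots> = norm A * norm x"
    by (simp add: norm_vec_def[of A] L2_set_left_distrib)
  finally show ?thesis .
qed

text \<open>
  The rows of the cofactor matrix of a \<open>3 \<times> 3\<close> matrix are the cross products of pairs of its rows.
  It is the gradient of the determinant, as a polynomial in the entries, and so serves to derive
  Jacobi's formula by direct differentiation.
\<close>

definition cofactor_matrix :: "real^3^3 \<Rightarrow> real^3^3" where
  "cofactor_matrix A =
     vector [cross3 (A$2) (A$3), cross3 (A$3) (A$1), cross3 (A$1) (A$2)]"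

lemma matrix_mult_transpose_cofactor:
  "A ** transpose (cofactor_matrix A) = det A *\<^sub>R mat 1"
  by (simp add: cofactor_matrix_def matrix_matrix_mult_def transpose_def mat_def
      cross3_simps forall_3)

lemma cofactor_matrix_eq:
  assumes "det A \<noteq> 0"
  shows "cofactor_matrix A = det A *\<^sub>R transpose (matrix_inv A)"
proof -
  have "transpose (cofactor_matrix A)
      = (matrix_inv A ** A) ** transpose (cofactor_matrix A)"
    using assms by (simp add: matrix_inv_inverse)
  also have "\<dots> = matrix_inv A ** (det A *\<^sub>R mat 1)"
    by (simp add: matrix_mul_assoc[symmetric] matrix_mult_transpose_cofactor)
  also have "\<dots> = det A *\<^sub>R matrix_inv A"
    by (simp add: matrix_scalar_ac)
  finally have "transpose (transpose (cofactor_matrix A)) = transpose (det A *\<^sub>R matrix_inv A)"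
    by (rule arg_cong)
  then show ?thesis by (simp add: transpose_scalar)
qed

text \<open>
  Jacobi's formula. Each product in the expansion of the determinant is differentiated entry by
  entry, and the terms with a fixed \<open>A' $ i $ j\<close> collect to the corresponding cofactor.
\<close>

lemma has_real_derivative_det:
  fixes A :: "real \<Rightarrow> real^3^3"
  assumes "(A has_vector_derivative A') (at t)" and "det (A t) \<noteq> 0"
  shows "((\<lambda>t. det (A t)) has_real_derivative
            det (A t) * (transpose (matrix_inv (A t)) \<bullet> A')) (at t)"
proof -
  have [derivative_intros]:
    "((\<lambda>t. A t $ i $ j) has_real_derivative A' $ i $ j) (at t)" for i j
  proof -
    have "bounded_linear (\<lambda>M::real^3^3. M $ i $ j)"
      by (intro bounded_linear_compose[OF bounded_linear_vec_nth] bounded_linear_vec_nth)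
    from bounded_linear.has_vector_derivative[OF this assms(1)]
    show ?thesis by (simp add: has_real_derivative_iff_has_vector_derivative)
  qed
  have "((\<lambda>t. det (A t)) has_real_derivative (cofactor_matrix (A t) \<bullet> A')) (at t)"
    unfolding det_3
    by (rule derivative_eq_intros refl)+
       (simp add: cofactor_matrix_def cross3_simps)
  then show ?thesis using assms(2) by (simp add: cofactor_matrix_eq)
qed

text \<open>
  Hadamard's inequality bounds the determinant by the product of the lengths of the rows: it is
  their triple product, and a cross product is no longer than the product of the lengths. Each row
  is in turn no longer than the whole matrix.
\<close>

lemma det_le_norm_cubed:
  fixes A :: "real^3^3"
  shows "det A \<le> norm A ^ 3"
proof -
  have A: "A = vector [A$1, A$2, A$3]" by (simp add: vec_eq_iff forall_3)
  have cross: "norm (cross3 x y) \<le> norm x * norm y" for x y :: "real^3"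
  proof (rule power2_le_imp_le)
    show "(norm (cross3 x y))\<^sup>2 \<le> (norm x * norm y)\<^sup>2"
      unfolding norm_cross_dot[symmetric] by simp
  qed simp
  have "det A = A$1 \<bullet> cross3 (A$2) (A$3)"
    by (subst A) (simp add: dot_cross_det)
  also have "\<dots> \<le> norm (A$1) * norm (cross3 (A$2) (A$3))"
    by (rule norm_cauchy_schwarz)
  also have "\<dots> \<le> norm (A$1) * (norm (A$2) * norm (A$3))"
    by (intro mult_left_mono cross) simp
  also have "\<dots> \<le> norm A * (norm A * norm A)"
    by (intro mult_mono Finite_Cartesian_Product.norm_nth_le) auto
  finally show ?thesis by (simp add: power3_eq_cube mult.assoc)
qed

lemma diameter_image_ball_le:
  fixes A :: "real^'n^'m"
  shows "diameter ((\<lambda>y. A *v y) ` ball 0 1) \<le> 2 * norm A"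
proof (rule diameter_le)
  fix u v assume "u \<in> (\<lambda>y. A *v y) ` ball 0 1" "v \<in> (\<lambda>y. A *v y) ` ball 0 1"
  then obtain x y where xy: "u = A *v x" "v = A *v y" "norm x < 1" "norm y < 1" by auto
  have "norm (x - y) \<le> 2" using xy norm_triangle_ineq4[of x y] by linarith
  then have "norm A * norm (x - y) \<le> norm A * 2" by (rule mult_left_mono) simp
  then show "norm (u - v) \<le> 2 * norm A"
    using norm_matrix_vector_mult_le[of A "x - y"] xy
    by (simp add: matrix_vector_mult_diff_distrib)
qed auto

lemma norm_le_diameter_image_ball:
  fixes A :: "real^'n^'m"
  shows "norm A \<le> real (CARD('m) * CARD('n)) * diameter ((\<lambda>y. A *v y) ` ball 0 1)"
    (is "_ \<le> _ * diameter ?S")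
proof -
  have bdd: "bounded ?S"
    by (intro bounded_linear_image matrix_vector_mul_bounded_linear bounded_ball)
  have entry: "\<bar>A $ i $ j\<bar> \<le> diameter ?S" for i j
  proof -
    \<comment> \<open>The two half unit vectors lie in the open ball and are mapped to points that differ
      by the \<open>j\<close>-th column of \<open>A\<close>.\<close>
    define v :: "real^'n" where "v = (1/2) *\<^sub>R axis j 1"
    have v: "v \<in> ball 0 1" "- v \<in> ball 0 1" by (simp_all add: v_def)
    have "A *v v - A *v (- v) = A *v (v - - v)"
      by (rule matrix_vector_mult_diff_distrib[symmetric])
    also have "v - - v = axis j 1" by (simp add: v_def flip: scaleR_add_left)
    also have "A *v axis j 1 = column j A" by (rule matrix_vector_mult_basis)
    finally have "dist (A *v v) (A *v (- v)) = norm (column j A)" by (simp add: dist_norm)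
    moreover have "dist (A *v v) (A *v (- v)) \<le> diameter ?S"
      by (rule diameter_bounded_bound[OF bdd]) (use v in blast)+
    moreover have "\<bar>A $ i $ j\<bar> \<le> norm (column j A)"
      using component_le_norm_cart[of "column j A" i] by (simp add: column_def)
    ultimately show ?thesis by simp
  qed
  have "norm A \<le> (\<Sum>i\<in>UNIV. norm (A $ i))"
    unfolding norm_vec_def[of A] by (rule L2_set_le_sum) simp
  also have "\<dots> \<le> (\<Sum>i\<in>(UNIV::'m set). \<Sum>j\<in>(UNIV::'n set). \<bar>A $ i $ j\<bar>)"
    by (intro sum_mono norm_le_l1_cart)
  also have "\<dots> \<le> (\<Sum>i\<in>(UNIV::'m set). \<Sum>j\<in>(UNIV::'n set). diameter ?S)"
    by (intro sum_mono entry)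
  finally show ?thesis by simp
qed

section \<open>Calculus on the line\<close>

lemma has_real_derivative_inner:
  assumes "(f has_vector_derivative f') (at t)" "(g has_vector_derivative g') (at t)"
  shows "((\<lambda>s. f s \<bullet> g s) has_real_derivative (f t \<bullet> g' + f' \<bullet> g t)) (at t)"
  using bounded_bilinear.has_vector_derivative[OF bounded_bilinear_inner assms]
  by (simp add: has_real_derivative_iff_has_vector_derivative)

lemma dominated_trans: "dominated x y \<Longrightarrow> dominated y z \<Longrightarrow> dominated x z"
  unfolding dominated_def
proof (elim exE conjE)
  fix c d :: real
  assume c: "0 < c" "\<forall>t. x t \<le> c * y t" and d: "0 < d" "\<forall>t. y t \<le> d * z t"
  have "x t \<le> (c * d) * z t" for t
    using order_trans[OF c(2)[rule_format] mult_left_mono[OF d(2)[rule_format]]] c(1)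
    by (simp add: mult.assoc)
  then show "\<exists>c>0. \<forall>t. x t \<le> c * z t" using c(1) d(1) by (intro exI[of _ "c * d"]) simp
qed

text \<open>
  A bound for large \<open>\<bar>t\<bar>\<close> is enough: on the remaining compact interval the continuous quotient
  \<open>f / g\<close> is bounded. This is where the estimates become uniform over all times.
\<close>

lemma dominated_if_large:
  assumes f: "continuous_on UNIV f" and g: "continuous_on UNIV g"
    and pos: "\<And>t. 0 < g t"
    and c: "0 < c" and large: "\<And>t. T \<le> \<bar>t\<bar> \<Longrightarrow> f t \<le> c * g t"
  shows "dominated f g"
proof -
  have "compact ((\<lambda>t. f t / g t) ` {-T..T})"
    by (intro compact_continuous_image continuous_intros
        continuous_on_subset[OF f] continuous_on_subset[OF g])
       (use pos in \<open>auto simp: less_imp_neq[OF pos, symmetric]\<close>)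
  then obtain b where b: "\<And>t. t \<in> {-T..T} \<Longrightarrow> \<bar>f t / g t\<bar> \<le> b"
    unfolding real_norm_def[symmetric] by (meson bounded_iff compact_imp_bounded imageI)
  have "f t \<le> (c + \<bar>b\<bar>) * g t" for t
  proof (cases "T \<le> \<bar>t\<bar>")
    case True
    have "c * g t \<le> (c + \<bar>b\<bar>) * g t" using pos[of t] by (intro mult_right_mono) auto
    with large[OF True] show ?thesis by linarith
  next
    case False
    then have "\<bar>f t / g t\<bar> \<le> b" by (intro b) auto
    then have "f t / g t \<le> c + \<bar>b\<bar>" using c by linarith
    then show ?thesis using pos[of t] by (simp add: divide_le_eq)
  qed
  then show ?thesis unfolding dominated_def using c by (intro exI[of _ "c + \<bar>b\<bar>"]) auto
qed

section \<open>Conservation of energy and growth of affine motions\<close>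

locale affine_motion =
  fixes \<gamma> :: real and A A' A'' :: "real \<Rightarrow> real^3^3"
  assumes gamma: "\<gamma> > 1"
    and det_pos: "\<And>t. det (A t) > 0"
    and deriv_A: "\<And>t. (A has_vector_derivative A' t) (at t)"
    and deriv_A': "\<And>t. (A' has_vector_derivative A'' t) (at t)"
    and accel: "\<And>t. A'' t = (det (A t) powr (1 - \<gamma>)) *\<^sub>R transpose (matrix_inv (A t))"
begin

definition internal_energy :: "real \<Rightarrow> real" where
  "internal_energy t = det (A t) powr (1 - \<gamma>) / (\<gamma> - 1)"

definition energy :: "real \<Rightarrow> real" where
  "energy t = (A' t \<bullet> A' t) / 2 + internal_energy t"

text \<open>
  The first term vanishes along free expansion \<open>A t = t *\<^sub>R V\<close>; the weight \<open>t\<^sup>2\<close> makes the terms with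
  \<open>A'' t \<bullet> A' t\<close> cancel in the derivative.
\<close>

definition conformal_energy :: "real \<Rightarrow> real" where
  "conformal_energy t =
     ((A t - t *\<^sub>R A' t) \<bullet> (A t - t *\<^sub>R A' t)) / 2 + t\<^sup>2 * internal_energy t"

lemma internal_energy_pos: "internal_energy t > 0"
  using det_pos[of t] gamma by (simp add: internal_energy_def)

lemma inner_A_accel: "A t \<bullet> A'' t = 3 * (\<gamma> - 1) * internal_energy t"
proof -
  have "A t \<bullet> A'' t = det (A t) powr (1 - \<gamma>) * 3"
    using inner_transpose_matrix_inv[of "A t"] det_pos[of t] by (simp add: accel)
  also have "det (A t) powr (1 - \<gamma>) = (\<gamma> - 1) * internal_energy t"
    using gamma by (simp add: internal_energy_def)
  finally show ?thesis by simp
qed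

lemma deriv_internal_energy:
  "(internal_energy has_real_derivative - (A'' t \<bullet> A' t)) (at t)"
proof -
  let ?D = "det (A t) * (transpose (matrix_inv (A t)) \<bullet> A' t)"
  have "((\<lambda>t. det (A t)) has_real_derivative ?D) (at t)"
    using det_pos[of t] by (intro has_real_derivative_det deriv_A) auto
  from DERIV_cdivide[OF DERIV_fun_powr[OF this det_pos], of "1 - \<gamma>" "\<gamma> - 1"]
  have "(internal_energy has_real_derivative
      (1 - \<gamma>) * det (A t) powr (1 - \<gamma> - 1) * ?D / (\<gamma> - 1)) (at t)"
    by (simp add: internal_energy_def[abs_def])
  moreover have "det (A t) powr (1 - \<gamma> - 1) * det (A t) = det (A t) powr (1 - \<gamma>)"
    using powr_mult_base[of "det (A t)" "1 - \<gamma> - 1"] det_pos[of t] by (simp add: mult.commute)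
  then have "(1 - \<gamma>) * det (A t) powr (1 - \<gamma> - 1) * ?D / (\<gamma> - 1)
      = (1 - \<gamma>) / (\<gamma> - 1) * (A'' t \<bullet> A' t)"
    by (simp add: accel mult.assoc[symmetric] del: diff_diff_eq)
  moreover have "(1 - \<gamma>) / (\<gamma> - 1) = - 1"
    using gamma by (simp add: field_simps)
  ultimately show ?thesis by simp
qed

lemma energy_const: "energy t = energy 0"
proof (rule DERIV_isconst_all[of energy], rule allI)
  show "(energy has_real_derivative 0) (at s)" for s
    unfolding energy_def[abs_def]
    by (auto intro!: derivative_eq_intros has_real_derivative_inner deriv_A' deriv_internal_energy
        simp: inner_commute)
qed

lemma energy_pos: "energy 0 > 0"
  unfolding energy_def using internal_energy_pos[of 0] by (intro add_nonneg_pos) auto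

lemma norm_A'_le: "norm (A' t) \<le> sqrt (2 * energy 0)"
proof (rule real_le_rsqrt)
  show "(norm (A' t))\<^sup>2 \<le> 2 * energy 0"
    unfolding energy_const[of t, symmetric] unfolding energy_def power2_norm_eq_inner
    using internal_energy_pos[of t] by simp
qed

text \<open>The speed is bounded, so the motion leaves \<open>A 0\<close> at most linearly.\<close>

lemma norm_A_dominated: "dominated (\<lambda>t. norm (A t)) (\<lambda>t. 1 + \<bar>t\<bar>)"
proof -
  let ?v = "sqrt (2 * energy 0)"
  let ?c = "norm (A 0) + ?v"
  have v: "?v > 0" using energy_pos by simp
  have "norm (A t) \<le> ?c * (1 + \<bar>t\<bar>)" for t
  proof -
    have "norm (A t - A 0) \<le> ?v * norm (t - 0)"
    proof (rule differentiable_bound[OF convex_UNIV])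
      show "(A has_derivative (\<lambda>h. h *\<^sub>R A' s)) (at s)" for s
        using deriv_A[of s] by (simp add: has_vector_derivative_def)
      show "onorm (\<lambda>h. h *\<^sub>R A' s) \<le> ?v" for s
        using mult_right_mono[OF norm_A'_le[of s]] by (intro onorm_le) (simp add: mult.commute)
    qed auto
    moreover have "norm (A t) \<le> norm (A 0) + norm (A t - A 0)"
      using norm_triangle_sub[of "A t" "A 0"] by simp
    moreover have "0 \<le> norm (A 0) * \<bar>t\<bar>" by simp
    moreover have "?c * (1 + \<bar>t\<bar>) = norm (A 0) + norm (A 0) * \<bar>t\<bar> + ?v + ?v * norm (t - 0)"
      by (simp add: algebra_simps)
    ultimately show ?thesis using v by linarith
  qed
  moreover have "?c > 0" using v by (intro add_nonneg_pos) auto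
  ultimately show ?thesis unfolding dominated_def by blast
qed

lemma continuous_A: "continuous_on UNIV A"
  using deriv_A by (intro continuous_at_imp_continuous_on ballI has_vector_derivative_continuous)

text \<open>
  The second derivative of \<open>\<bar>A\<bar>\<^sup>2\<close> stays above the positive constant \<open>k\<close>, so after subtraction of
  \<open>k/2 * t\<^sup>2\<close> a convex function remains, which lies above its tangent at \<open>0\<close>. The quadratic term
  beats the linear one for large \<open>\<bar>t\<bar>\<close>.
\<close>

lemma one_plus_abs_dominated: "dominated (\<lambda>t. 1 + \<bar>t\<bar>) (\<lambda>t. norm (A t))"
proof -
  \<comment> \<open>The kinetic energy enters the second derivative with weight \<open>4\<close> and the internal energy with
    weight \<open>6 * (\<gamma> - 1)\<close>; the smaller weight works for their sum.\<close>
  define k where "k = min 4 (6 * (\<gamma> - 1)) * energy 0"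
  have k: "k > 0" using gamma energy_pos by (simp add: k_def)
  define X X' X'' where "X t = A t \<bullet> A t" and "X' t = 2 * (A t \<bullet> A' t)"
    and "X'' t = 2 * (A' t \<bullet> A' t) + 6 * (\<gamma> - 1) * internal_energy t" for t
  have dX: "(X has_real_derivative X' t) (at t)" for t
    unfolding X_def[abs_def] X'_def
    using has_real_derivative_inner[OF deriv_A deriv_A] by (simp add: inner_commute)
  have dX': "(X' has_real_derivative X'' t) (at t)" for t
    unfolding X'_def[abs_def] X''_def
    using DERIV_cmult[OF has_real_derivative_inner[OF deriv_A deriv_A'], of 2]
    by (simp add: inner_A_accel algebra_simps)
  have X'': "k \<le> X'' t" for t
  proof -
    let ?m = "min 4 (6 * (\<gamma> - 1))"
    have "?m * ((A' t \<bullet> A' t) / 2) \<le> 4 * ((A' t \<bullet> A' t) / 2)"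
      by (rule mult_right_mono) auto
    moreover have "?m * internal_energy t \<le> 6 * (\<gamma> - 1) * internal_energy t"
      using internal_energy_pos[of t] by (intro mult_right_mono) auto
    ultimately show ?thesis
      unfolding k_def X''_def energy_const[of t, symmetric] unfolding energy_def distrib_left
      by linarith
  qed
  define Y where "Y t = X t - k / 2 * t\<^sup>2" for t
  have "convex_on UNIV Y"
  proof (rule f''_ge0_imp_convex)
    show "(Y has_real_derivative (X' t - k * t)) (at t)" for t
      unfolding Y_def[abs_def] by (auto intro!: derivative_eq_intros dX)
    show "((\<lambda>t. X' t - k * t) has_real_derivative (X'' t - k)) (at t)" for t
      by (auto intro!: derivative_eq_intros dX')
  qed (use X'' in auto)
  then have tangent: "Y t - Y 0 \<ge> X' 0 * (t - 0)" for t
  proof (rule convex_on_imp_above_tangent)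
    show "(Y has_real_derivative X' 0) (at 0 within UNIV)"
      unfolding Y_def[abs_def] by (auto intro!: derivative_eq_intros dX)
  qed auto
  have lower: "k / 2 * t\<^sup>2 - \<bar>X' 0\<bar> * \<bar>t\<bar> \<le> X t" for t
  proof -
    have "X 0 \<ge> 0" by (simp add: X_def)
    moreover have "- (\<bar>X' 0\<bar> * \<bar>t\<bar>) \<le> X' 0 * t"
      by (metis abs_ge_minus_self abs_mult minus_le_iff)
    ultimately show ?thesis using tangent[of t] by (simp add: Y_def)
  qed
  \<comment> \<open>From this time on the linear term is at most half of the quadratic one.\<close>
  define T where "T = max 1 (4 * \<bar>X' 0\<bar> / k)"
  show ?thesis
  proof (rule dominated_if_large)
    show "continuous_on UNIV (\<lambda>t::real. 1 + \<bar>t\<bar>)" by (intro continuous_intros)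
    show "continuous_on UNIV (\<lambda>t. norm (A t))" by (intro continuous_intros continuous_A)
    show "0 < norm (A t)" for t using det_pos[of t] by (auto simp: det_3)
    show "0 < 4 / sqrt k" using k by simp
    show "1 + \<bar>t\<bar> \<le> 4 / sqrt k * norm (A t)" if t: "T \<le> \<bar>t\<bar>" for t
    proof -
      have t1: "1 \<le> \<bar>t\<bar>" and "4 * \<bar>X' 0\<bar> / k \<le> \<bar>t\<bar>" using t by (auto simp: T_def)
      then have "\<bar>X' 0\<bar> \<le> k / 4 * \<bar>t\<bar>" using k by (simp add: field_simps)
      then have "\<bar>X' 0\<bar> * \<bar>t\<bar> \<le> k / 4 * \<bar>t\<bar> * \<bar>t\<bar>" by (rule mult_right_mono) simp
      also have "\<dots> = k / 4 * t\<^sup>2" by (simp add: power2_eq_square)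
      finally have "k / 4 * t\<^sup>2 \<le> X t" using lower[of t] by linarith
      then have "(sqrt k * \<bar>t\<bar> / 2)\<^sup>2 \<le> (norm (A t))\<^sup>2"
        using k by (simp add: X_def power2_norm_eq_inner power_mult_distrib power_divide)
      then have "sqrt k * \<bar>t\<bar> / 2 \<le> norm (A t)" by (rule power2_le_imp_le) simp
      then have "2 * \<bar>t\<bar> \<le> 4 / sqrt k * norm (A t)" using k by (simp add: field_simps)
      then show ?thesis using t1 by linarith
    qed
  qed
qed

text \<open>
  The derivative of \<open>A - t A'\<close> is \<open>- t A''\<close>, so the first term contributes
  \<open>- t A \<bullet> A'' + t\<^sup>2 A' \<bullet> A''\<close>. The last product cancels against \<open>t\<^sup>2 U'\<close>, and both \<open>A \<bullet> A''\<close> and the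
  derivative of the weight are multiples of the internal energy.
\<close>

lemma deriv_conformal_energy:
  "(conformal_energy has_real_derivative (5 - 3 * \<gamma>) * (t * internal_energy t)) (at t)"
proof -
  have d: "((\<lambda>t. A t - t *\<^sub>R A' t) has_vector_derivative - (t *\<^sub>R A'' t)) (at t)"
    by (rule derivative_eq_intros deriv_A deriv_A' refl)+ simp
  have "(conformal_energy has_real_derivative
      - t * ((A t - t *\<^sub>R A' t) \<bullet> A'' t)
      + (2 * t * internal_energy t - t\<^sup>2 * (A'' t \<bullet> A' t))) (at t)"
    unfolding conformal_energy_def[abs_def]
    by (auto intro!: derivative_eq_intros has_real_derivative_inner[OF d d] deriv_internal_energy
        simp: inner_commute)
  moreover have "- t * ((A t - t *\<^sub>R A' t) \<bullet> A'' t)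
      + (2 * t * internal_energy t - t\<^sup>2 * (A'' t \<bullet> A' t))
      = (5 - 3 * \<gamma>) * (t * internal_energy t)"
    by (simp add: inner_diff_left inner_A_accel inner_commute[of "A' t"] power2_eq_square
        algebra_simps)
  ultimately show ?thesis by simp
qed

lemma internal_energy_le_conformal_energy: "t\<^sup>2 * internal_energy t \<le> conformal_energy t"
  by (simp add: conformal_energy_def)

text \<open>
  A Gronwall argument: the differential inequality \<open>t H' \<le> \<kappa> H\<close> for the conformal energy \<open>H\<close> says
  that \<open>H t * t powr (- \<kappa>)\<close> is nonincreasing. Taking the maximum with \<open>0\<close> in \<open>\<kappa>\<close> covers the case
  \<open>\<gamma> > 5/3\<close>, where the factor \<open>5 - 3 * \<gamma>\<close> is negative and \<open>t\<^sup>2 U \<le> H\<close> cannot be multiplied by it.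
\<close>

lemma internal_energy_decay:
  defines "\<kappa> \<equiv> max 0 (5 - 3 * \<gamma>)"
  assumes "1 \<le> t"
  shows "internal_energy t \<le> conformal_energy 1 * t powr (\<kappa> - 2)"
proof -
  have "conformal_energy t * t powr (- \<kappa>) \<le> conformal_energy 1 * 1 powr (- \<kappa>)"
  proof (rule DERIV_nonpos_imp_nonincreasing[OF \<open>1 \<le> t\<close>])
    fix s :: real assume s: "1 \<le> s" "s \<le> t"
    let ?D = "s powr (- \<kappa> - 1) * ((5 - 3 * \<gamma>) * (s\<^sup>2 * internal_energy s) - \<kappa> * conformal_energy s)"
    have pw: "s powr (- \<kappa>) = s * s powr (- \<kappa> - 1)"
      using s by (simp add: powr_mult_base)
    have "((\<lambda>s. conformal_energy s * s powr (- \<kappa>)) has_real_derivative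
        (5 - 3 * \<gamma>) * (s * internal_energy s) * s powr (- \<kappa>)
        + (- \<kappa> * s powr (- \<kappa> - 1)) * conformal_energy s) (at s)"
      using s by (intro DERIV_mult deriv_conformal_energy has_real_derivative_powr) auto
    also have "(5 - 3 * \<gamma>) * (s * internal_energy s) * s powr (- \<kappa>)
        + (- \<kappa> * s powr (- \<kappa> - 1)) * conformal_energy s = ?D"
      unfolding pw by (simp add: algebra_simps power2_eq_square)
    finally have "((\<lambda>s. conformal_energy s * s powr (- \<kappa>)) has_real_derivative ?D) (at s)" .
    moreover have "?D \<le> 0"
    proof (rule mult_nonneg_nonpos)
      have "(5 - 3 * \<gamma>) * (s\<^sup>2 * internal_energy s) \<le> \<kappa> * (s\<^sup>2 * internal_energy s)"
        using internal_energy_pos[of s] by (intro mult_right_mono) (auto simp: \<kappa>_def)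
      also have "\<dots> \<le> \<kappa> * conformal_energy s"
        by (rule mult_left_mono[OF internal_energy_le_conformal_energy]) (simp add: \<kappa>_def)
      finally show "(5 - 3 * \<gamma>) * (s\<^sup>2 * internal_energy s) - \<kappa> * conformal_energy s \<le> 0"
        by simp
    qed simp
    ultimately show "\<exists>y. ((\<lambda>s. conformal_energy s * s powr (- \<kappa>)) has_real_derivative y) (at s)
        \<and> y \<le> 0" by blast
  qed
  then have "conformal_energy t \<le> conformal_energy 1 * t powr \<kappa>"
    using assms by (simp add: powr_minus field_simps)
  with internal_energy_le_conformal_energy[of t]
  have "t\<^sup>2 * internal_energy t \<le> conformal_energy 1 * t powr \<kappa>" by linarith
  moreover have "t powr (\<kappa> - 2) = t powr \<kappa> / t\<^sup>2"
    using assms by (simp add: powr_diff)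
  ultimately show ?thesis using \<open>1 \<le> t\<close> by (simp add: pos_le_divide_eq mult.commute)
qed

text \<open>
  Since the internal energy is a negative power of the determinant, its decay is growth of the
  determinant, and the exponents match because \<open>\<kappa> - 2 = - growth_exponent \<gamma> * (\<gamma> - 1)\<close> in both
  ranges of \<open>\<gamma>\<close>.
\<close>

lemma det_growth_forward:
  "\<exists>c>0. \<forall>t\<ge>1. t powr growth_exponent \<gamma> \<le> c * det (A t)"
proof -
  define C where "C = (\<gamma> - 1) * conformal_energy 1"
  have C: "C > 0"
    using internal_energy_pos[of 1] internal_energy_le_conformal_energy[of 1] gamma
    by (simp add: C_def)
  have exponent: "max 0 (5 - 3 * \<gamma>) - 2 = - (growth_exponent \<gamma> * (\<gamma> - 1))"
  proof -
    have "2 / (\<gamma> - 1) * (\<gamma> - 1) = 2" using gamma by (simp add: field_simps)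
    then show ?thesis by (auto simp: growth_exponent_def max_def)
  qed
  have "t powr growth_exponent \<gamma> \<le> C powr (1 / (\<gamma> - 1)) * det (A t)" if t: "1 \<le> t" for t
  proof -
    have "det (A t) powr - (\<gamma> - 1) \<le> C * t powr - (growth_exponent \<gamma> * (\<gamma> - 1))"
      using internal_energy_decay[OF t, unfolded exponent] gamma
      by (simp add: C_def internal_energy_def divide_le_eq mult_ac)
    then have "t powr (growth_exponent \<gamma> * (\<gamma> - 1)) \<le> C * det (A t) powr (\<gamma> - 1)"
      using t det_pos[of t] unfolding powr_minus by (simp add: field_simps)
    then have "(t powr (growth_exponent \<gamma> * (\<gamma> - 1))) powr (1 / (\<gamma> - 1))
        \<le> (C * det (A t) powr (\<gamma> - 1)) powr (1 / (\<gamma> - 1))"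
      using gamma by (intro powr_mono2) auto
    then show ?thesis
      using gamma C t det_pos[of t] by (simp add: powr_mult powr_powr)
  qed
  then show ?thesis using C by (intro exI[of _ "C powr (1 / (\<gamma> - 1))"]) auto
qed

text \<open>
  The equation of motion is of second order without a first-order term, hence invariant under
  time reversal. This transfers the growth of the determinant to negative times.
\<close>

lemma affine_motion_reversed:
  "affine_motion \<gamma> (\<lambda>t. A (- t)) (\<lambda>t. - A' (- t)) (\<lambda>t. A'' (- t))"
proof
  have flip: "((\<lambda>t. - t) has_vector_derivative -1) (at t)" for t :: real
    by (auto intro!: derivative_eq_intros)
  show "((\<lambda>t. A (- t)) has_vector_derivative - A' (- t)) (at t)" for t
    using vector_diff_chain_at[OF flip deriv_A] by (simp add: o_def)
  show "((\<lambda>t. - A' (- t)) has_vector_derivative A'' (- t)) (at t)" for t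
    using has_vector_derivative_minus[OF vector_diff_chain_at[OF flip deriv_A']]
    by (simp add: o_def)
qed (use gamma det_pos accel in auto)

lemma continuous_det: "continuous_on UNIV (\<lambda>t. det (A t))"
  using DERIV_isCont[OF has_real_derivative_det[OF deriv_A less_imp_neq[OF det_pos, symmetric]]]
  by (simp add: continuous_at_imp_continuous_on)

lemma det_growth: "dominated (\<lambda>t. 1 + \<bar>t\<bar> powr growth_exponent \<gamma>) (\<lambda>t. det (A t))"
proof -
  have p: "growth_exponent \<gamma> > 0" using gamma by (simp add: growth_exponent_def)
  obtain c where c: "c > 0" "\<And>t. 1 \<le> t \<Longrightarrow> t powr growth_exponent \<gamma> \<le> c * det (A t)"
    using det_growth_forward by blast
  obtain d where d: "d > 0" "\<And>t. 1 \<le> t \<Longrightarrow> t powr growth_exponent \<gamma> \<le> d * det (A (- t))"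
    using affine_motion.det_growth_forward[OF affine_motion_reversed] by blast
  show ?thesis
  proof (rule dominated_if_large[OF _ continuous_det det_pos])
    show "continuous_on UNIV (\<lambda>t::real. 1 + \<bar>t\<bar> powr growth_exponent \<gamma>)"
      by (intro continuous_intros continuous_on_powr') (use p in auto)
    show "0 < 2 * (c + d)" using c(1) d(1) by simp
    show "1 + \<bar>t\<bar> powr growth_exponent \<gamma> \<le> 2 * (c + d) * det (A t)" if t: "1 \<le> \<bar>t\<bar>" for t
    proof -
      have "0 < c * det (A t)" "0 < d * det (A t)" using c(1) d(1) det_pos[of t] by auto
      moreover have "\<bar>t\<bar> powr growth_exponent \<gamma> \<le> c * det (A t)
          \<or> \<bar>t\<bar> powr growth_exponent \<gamma> \<le> d * det (A t)"
        using c(2)[of t] d(2)[of "- t"] t by (cases "0 \<le> t") auto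
      moreover have "1 \<le> \<bar>t\<bar> powr growth_exponent \<gamma>"
        using t p by (simp add: ge_one_powr_ge_zero)
      ultimately show ?thesis by (auto simp: algebra_simps)
    qed
  qed
qed

lemma det_dominated: "dominated (\<lambda>t. det (A t)) (\<lambda>t. 1 + \<bar>t\<bar> ^ 3)"
proof -
  obtain c where c: "c > 0" "\<And>t. norm (A t) \<le> c * (1 + \<bar>t\<bar>)"
    using norm_A_dominated unfolding dominated_def by blast
  have "det (A t) \<le> (c ^ 3 * 8) * (1 + \<bar>t\<bar> ^ 3)" for t
  proof -
    have "det (A t) \<le> (c * (1 + \<bar>t\<bar>)) ^ 3"
      by (rule order_trans[OF det_le_norm_cubed power_mono]) (use c in auto)
    moreover have "(1 + \<bar>t\<bar>) ^ 3 \<le> 8 * (1 + \<bar>t\<bar> ^ 3)"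
    proof -
      have "(1 + \<bar>t\<bar>) ^ 3 \<le> (2 * max 1 \<bar>t\<bar>) ^ 3" by (intro power_mono) auto
      also have "\<dots> = 8 * max 1 \<bar>t\<bar> ^ 3" by (simp add: power_mult_distrib)
      also have "\<dots> \<le> 8 * (1 + \<bar>t\<bar> ^ 3)" by (auto simp: max_def)
      finally show ?thesis .
    qed
    then have "c ^ 3 * (1 + \<bar>t\<bar>) ^ 3 \<le> c ^ 3 * (8 * (1 + \<bar>t\<bar> ^ 3))"
      using c(1) by (intro mult_left_mono) auto
    ultimately show ?thesis unfolding power_mult_distrib mult.assoc by (rule order_trans)
  qed
  then show ?thesis unfolding dominated_def using c(1) by (intro exI[of _ "c ^ 3 * 8"]) auto
qed

lemma measure_moving_domain:
  "measure lebesgue (moving_domain A t) = measure lebesgue (ball (0::real^3) 1) * det (A t)"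
  unfolding moving_domain_def
  using det_pos[of t]
  by (subst measure_linear_image) (auto simp: mult.commute)

end

section \<open>Asymptotics of the moving domain\<close>

theorem theorem3:
  fixes \<gamma> :: real and A A' A'' :: "real \<Rightarrow> real^3^3"
  assumes "\<gamma> > 1"
    and "\<And>t. A t \<in> GL_plus"
    and "continuous_on UNIV A"
    and "\<And>t. (A has_vector_derivative A' t) (at t)"
    and "\<And>t. (A' has_vector_derivative A'' t) (at t)"
    and "continuous_on UNIV A''"
    and "\<And>t. A'' t = (det (A t) powr (1 - \<gamma>)) *\<^sub>R transpose (matrix_inv (A t))"
  shows "comparable (\<lambda>t. diameter (moving_domain A t))
           (\<lambda>t. sqrt (trace (A t ** transpose (A t))))
       \<and> comparable (\<lambda>t. sqrt (trace (A t ** transpose (A t)))) (\<lambda>t. 1 + \<bar>t\<bar>)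
       \<and> dominated (\<lambda>t. 1 + \<bar>t\<bar> powr growth_exponent \<gamma>)
           (\<lambda>t. measure lebesgue (moving_domain A t))
       \<and> comparable (\<lambda>t. measure lebesgue (moving_domain A t)) (\<lambda>t. det (A t))
       \<and> dominated (\<lambda>t. det (A t)) (\<lambda>t. 1 + \<bar>t\<bar> ^ 3)"
proof -
  interpret affine_motion \<gamma> A A' A''
    using assms by unfold_locales (auto simp: GL_plus_def)
  have norm: "sqrt (trace (A t ** transpose (A t))) = norm (A t)" for t
    by (simp add: trace_matrix_mult_transpose norm_eq_sqrt_inner)
  have diam: "comparable (\<lambda>t. diameter (moving_domain A t)) (\<lambda>t. norm (A t))"
    unfolding comparable_def dominated_def moving_domain_def
    using diameter_image_ball_le[of "A _"] norm_le_diameter_image_ball[of "A _"]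
    by (intro conjI exI[of _ 2] exI[of _ "real (CARD(3) * CARD(3))"]) auto
  define b where "b = measure lebesgue (ball (0::real^3) 1)"
  have b: "b > 0" unfolding b_def by (simp add: content_ball_pos)
  have vol: "comparable (\<lambda>t. measure lebesgue (moving_domain A t)) (\<lambda>t. det (A t))"
    unfolding comparable_def dominated_def measure_moving_domain b_def[symmetric]
    using b by (intro conjI exI[of _ b] exI[of _ "1 / b"]) auto
  show ?thesis
    unfolding norm
    using diam norm_A_dominated one_plus_abs_dominated vol det_dominated
      dominated_trans[OF det_growth] by (simp add: comparable_def)
qed

end
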